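(* Let $g$ be a smooth vector field on $\mathbb{R}^n$ and let $\omega$ be a smooth 1-form on $\mathbb{R}^n$ such that $\omega(g)\neq 0$ at every point and $d\omega\wedge\omega=0$. For smooth vector fields $m,m'$ on $\mathbb{R}^n$ put $$\langle m,m'\rangle := [m,m']+\frac{\omega(m')}{\omega(g)}[g,m]-\frac{\omega(m)}{\omega(g)}[g,m'].$$ Then for all smooth vector fields $m_1,m_2,m_3$ on $\mathbb{R}^n$, $$\langle m_1,\langle m_2,m_3\rangle\rangle+\langle m_2,\langle m_3,m_1\rangle\rangle+\langle m_3,\langle m_1,m_2\rangle\rangle=0 .$$
   Context: $[\cdot,\cdot]$ denotes the usual Lie bracket of vector fields on $\mathbb{R}^n$, normalized so that $[m,\alpha m']=\alpha[m,m']+m(\alpha)m'$ for a smooth function $\alpha$. $\omega(m)$ (written $\omega m$ in the paper) is the function obtained by pairing the 1-form $\omega$ with the vector field $m$. *)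

theory Defs
  imports "HOL-Analysis.Analysis"
begin

text \<open>
  \<open>Ck k f\<close>: \<open>f\<close> is of class \<open>C\<^sup>k\<close> on the whole space. The domain is finite-dimensional,
  so it makes no difference that continuity of the derivative is asked direction by direction.
\<close>

primrec Ck :: "nat \<Rightarrow> ('a::euclidean_space \<Rightarrow> 'b::real_normed_vector) \<Rightarrow> bool" where
  "Ck 0 f \<longleftrightarrow> continuous_on UNIV f"
| "Ck (Suc k) f \<longleftrightarrow>
     (\<forall>x. f differentiable (at x)) \<and> (\<forall>v. Ck k (\<lambda>x. frechet_derivative f (at x) v))"

definition smooth :: "('a::euclidean_space \<Rightarrow> 'b::real_normed_vector) \<Rightarrow> bool" where
  "smooth f \<longleftrightarrow> (\<forall>k. Ck k f)"

text \<open>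
  A vector field on \<open>\<real>\<^sup>n\<close> is a map \<^typ>\<open>real^'n \<Rightarrow> real^'n\<close>, and a 1-form is a map into the dual
  space, \<^typ>\<open>real^'n \<Rightarrow> ((real^'n) \<Rightarrow>\<^sub>L real)\<close>. A 2-form or 3-form is given by its values on tangent
  vectors at each point.
\<close>

definition vf_apply :: "('a::euclidean_space \<Rightarrow> 'a) \<Rightarrow> ('a \<Rightarrow> 'b::real_normed_vector) \<Rightarrow> 'a \<Rightarrow> 'b" where
  "vf_apply m f = (\<lambda>x. frechet_derivative f (at x) (m x))"

definition lie_bracket :: "('a::euclidean_space \<Rightarrow> 'a) \<Rightarrow> ('a \<Rightarrow> 'a) \<Rightarrow> 'a \<Rightarrow> 'a" where
  "lie_bracket m m' = (\<lambda>x. vf_apply m m' x - vf_apply m' m x)"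

definition pairing :: "('a::euclidean_space \<Rightarrow> ('a \<Rightarrow>\<^sub>L real)) \<Rightarrow> ('a \<Rightarrow> 'a) \<Rightarrow> 'a \<Rightarrow> real" where
  "pairing \<omega> m = (\<lambda>x. blinfun_apply (\<omega> x) (m x))"

text \<open>
  In coordinates, \<open>ext_deriv\<close> is
  \<open>(d\<omega>)\<^sub>x(u, v) = (\<Sum>i j. (\<partial>\<^sub>i \<omega>\<^sub>j - \<partial>\<^sub>j \<omega>\<^sub>i)(x) u\<^sub>i v\<^sub>j)\<close>. The normalization of
  the wedge product has no factorials in front, that is, it is the sum over the (2,1)-shuffles.
\<close>

definition ext_deriv :: "('a::euclidean_space \<Rightarrow> ('a \<Rightarrow>\<^sub>L real)) \<Rightarrow> 'a \<Rightarrow> 'a \<Rightarrow> 'a \<Rightarrow> real" where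
  "ext_deriv \<omega> = (\<lambda>x u v.
     blinfun_apply (frechet_derivative \<omega> (at x) u) v -
     blinfun_apply (frechet_derivative \<omega> (at x) v) u)"

definition wedge_2_1 ::
    "('a::euclidean_space \<Rightarrow> 'a \<Rightarrow> 'a \<Rightarrow> real) \<Rightarrow> ('a \<Rightarrow> ('a \<Rightarrow>\<^sub>L real)) \<Rightarrow> 'a \<Rightarrow> 'a \<Rightarrow> 'a \<Rightarrow> 'a \<Rightarrow> real" where
  "wedge_2_1 \<beta> \<omega> = (\<lambda>x u v w.
     \<beta> x u v * blinfun_apply (\<omega> x) w -
     \<beta> x u w * blinfun_apply (\<omega> x) v +
     \<beta> x v w * blinfun_apply (\<omega> x) u)"

definition modified_bracket ::
    "('a::euclidean_space \<Rightarrow> 'a) \<Rightarrow> ('a \<Rightarrow> ('a \<Rightarrow>\<^sub>L real)) \<Rightarrow> ('a \<Rightarrow> 'a) \<Rightarrow> ('a \<Rightarrow> 'a) \<Rightarrow> 'a \<Rightarrow> 'a" where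
  "modified_bracket g \<omega> m m' = (\<lambda>x.
     lie_bracket m m' x
     + (pairing \<omega> m' x / pairing \<omega> g x) *\<^sub>R lie_bracket g m x
     - (pairing \<omega> m x / pairing \<omega> g x) *\<^sub>R lie_bracket g m' x)"

text \<open>The sign convention of the Lie bracket: \<open>[m, \<alpha> m'] = \<alpha> [m, m'] + m(\<alpha>) m'\<close>.\<close>

lemma lie_bracket_scaleR_right:
  fixes m m' :: "'a::euclidean_space \<Rightarrow> 'a" and \<alpha> :: "'a \<Rightarrow> real"
  assumes "\<alpha> differentiable (at x)" "m' differentiable (at x)" "m differentiable (at x)"
  shows "lie_bracket m (\<lambda>x. \<alpha> x *\<^sub>R m' x) x = \<alpha> x *\<^sub>R lie_bracket m m' x + vf_apply m \<alpha> x *\<^sub>R m' x"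
proof -
  note d = assms[unfolded frechet_derivative_works]
  have "frechet_derivative (\<lambda>x. \<alpha> x *\<^sub>R m' x) (at x) =
      (\<lambda>h. \<alpha> x *\<^sub>R frechet_derivative m' (at x) h + frechet_derivative \<alpha> (at x) h *\<^sub>R m' x)"
    using frechet_derivative_at[OF has_derivative_scaleR[OF d(1) d(2)]] by simp
  moreover have "frechet_derivative m (at x) (\<alpha> x *\<^sub>R m' x) = \<alpha> x *\<^sub>R frechet_derivative m (at x) (m' x)"
    using has_derivative_linear[OF d(3)] by (rule linear_cmul)
  ultimately show ?thesis
    by (simp add: lie_bracket_def vf_apply_def scaleR_diff_right)
qed

end

theory Submission
  imports Defs
begin

text \<open>
  Normalize \<open>\<theta> = \<omega> / \<omega>(g)\<close> and decompose \<open>m = X + a g\<close> with \<open>a = \<theta>(m)\<close> and \<open>\<omega>(X) = 0\<close>. In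
  this decomposition the modified bracket becomes
  \<open>\<langle>X + a g, Y + b g\<rangle> = [X, Y] + (X(b) - Y(a)) g\<close>.
  Frobenius integrability makes \<open>ker \<omega>\<close> a Lie algebra, so the modified bracket is the bracket of the
  semidirect product of \<open>ker \<omega>\<close> with its module of functions, regarded as an abelian ideal. The
  Jacobi identity follows from \<open>[X, Y] f = X (Y f) - Y (X f)\<close>, used for real-valued and for
  vector-valued \<open>f\<close>.
\<close>

subsection \<open>Closure properties of smooth maps\<close>

lemma frechet_derivative_eqI:
  "(f has_derivative f') (at x) \<Longrightarrow> frechet_derivative f (at x) = f'"
  by (rule frechet_derivative_at[symmetric])

lemma Ck_SucD: "Ck (Suc k) f \<Longrightarrow> Ck k f"
proof (induction k arbitrary: f)
  case 0
  then show ?case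
    by (auto intro!: differentiable_imp_continuous_on simp: differentiable_on_def)
next
  case (Suc k)
  then show ?case by (metis Ck.simps(2))
qed

lemma Ck_const: "Ck k (\<lambda>x. c)"
  by (induction k arbitrary: c) auto

lemma Ck_add: "Ck k f \<Longrightarrow> Ck k g \<Longrightarrow> Ck k (\<lambda>x. f x + g x)"
proof (induction k arbitrary: f g)
  case 0
  then show ?case by (auto intro: continuous_on_add)
next
  case (Suc k)
  have "frechet_derivative (\<lambda>x. f x + g x) (at x) =
      (\<lambda>h. frechet_derivative f (at x) h + frechet_derivative g (at x) h)" for x
    using Suc.prems
    by (intro frechet_derivative_eqI has_derivative_add) (auto simp flip: frechet_derivative_works)
  then show ?case using Suc by auto
qed

text \<open>One induction covers scalar multiples, products, inner products and the pairing. By the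
  product rule each summand of the derivative has one factor differentiated and the other merely
  lowered by \<open>Ck_SucD\<close>, so \<open>f\<close> and \<open>g\<close> must stay
  arbitrary.\<close>

lemma Ck_bilinear:
  assumes B: "bounded_bilinear B"
  shows "Ck k f \<Longrightarrow> Ck k g \<Longrightarrow> Ck k (\<lambda>x. B (f x) (g x))"
proof (induction k arbitrary: f g)
  case 0
  then show ?case by (auto intro: bounded_bilinear.continuous_on[OF B])
next
  case (Suc k)
  have d: "((\<lambda>x. B (f x) (g x)) has_derivative
      (\<lambda>h. B (f x) (frechet_derivative g (at x) h) + B (frechet_derivative f (at x) h) (g x))) (at x)" for x
    using Suc.prems by (intro bounded_bilinear.FDERIV[OF B]) (auto simp flip: frechet_derivative_works)
  moreover have "Ck k (\<lambda>x. B (f x) (frechet_derivative g (at x) v) + B (frechet_derivative f (at x) v) (g x))" for v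
    using Suc.prems Suc.prems[THEN Ck_SucD] by (intro Ck_add Suc.IH) auto
  ultimately show ?case by (auto simp: frechet_derivative_eqI[OF d] intro: differentiableI)
qed

text \<open>The derivative of \<open>1/f\<close> is a product of \<open>f'\<close> with two copies
  of \<open>1/f\<close>, so the induction hypothesis for \<open>1/f\<close> itself suffices.\<close>

lemma Ck_inverse:
  fixes f :: "'a::euclidean_space \<Rightarrow> real"
  assumes "\<And>x. f x \<noteq> 0"
  shows "Ck k f \<Longrightarrow> Ck k (\<lambda>x. inverse (f x))"
proof (induction k)
  case 0
  then show ?case using assms by (auto intro: continuous_on_inverse)
next
  case (Suc k)
  have d: "((\<lambda>x. inverse (f x)) has_derivative
      (\<lambda>h. (- 1) * (inverse (f x) * frechet_derivative f (at x) h * inverse (f x)))) (at x)" for x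
    using Deriv.has_derivative_inverse[where f = f, OF assms] Suc.prems
    by (auto simp flip: frechet_derivative_works)
  moreover have "Ck k (\<lambda>x. (- 1) * (inverse (f x) * frechet_derivative f (at x) v * inverse (f x)))" for v
    using Suc.prems Suc.IH[OF Ck_SucD[OF Suc.prems]]
    by (intro Ck_bilinear[OF bounded_bilinear_mult] Ck_const) auto
  ultimately show ?case by (auto simp: frechet_derivative_eqI[OF d] intro: differentiableI)
qed

lemma smooth_has_derivative:
  "smooth f \<Longrightarrow> (f has_derivative frechet_derivative f (at x)) (at x)"
  unfolding smooth_def by (metis Ck.simps(2) frechet_derivative_works)

lemma smooth_frechet_derivative: "smooth f \<Longrightarrow> smooth (\<lambda>x. frechet_derivative f (at x) v)"
  unfolding smooth_def by (metis Ck.simps(2))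

lemma smooth_const: "smooth (\<lambda>x. c)"
  by (simp add: smooth_def Ck_const)

lemma smooth_add: "smooth f \<Longrightarrow> smooth g \<Longrightarrow> smooth (\<lambda>x. f x + g x)"
  by (simp add: smooth_def Ck_add)

lemma smooth_bilinear:
  "bounded_bilinear B \<Longrightarrow> smooth f \<Longrightarrow> smooth g \<Longrightarrow> smooth (\<lambda>x. B (f x) (g x))"
  by (simp add: smooth_def Ck_bilinear)

lemmas smooth_scaleR = smooth_bilinear[OF bounded_bilinear_scaleR]

lemma smooth_diff:
  assumes "smooth f" "smooth g"
  shows "smooth (\<lambda>x. f x - g x)"
  using smooth_add[OF assms(1) smooth_scaleR[OF smooth_const[of "- 1"] assms(2)]] by simp

lemma smooth_sum: "(\<And>i. i \<in> I \<Longrightarrow> smooth (f i)) \<Longrightarrow> smooth (\<lambda>x. \<Sum>i\<in>I. f i x)"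
  by (induction I rule: infinite_finite_induct) (auto intro: smooth_add smooth_const)

lemma smooth_divide:
  fixes f g :: "'a::euclidean_space \<Rightarrow> real"
  assumes "smooth f" "smooth g" "\<And>x. g x \<noteq> 0"
  shows "smooth (\<lambda>x. f x / g x)"
  using assms unfolding divide_inverse
  by (intro smooth_bilinear[OF bounded_bilinear_mult]) (auto simp: smooth_def Ck_inverse)

lemma smooth_pairing: "smooth \<omega> \<Longrightarrow> smooth m \<Longrightarrow> smooth (pairing \<omega> m)"
  unfolding pairing_def by (rule smooth_bilinear[OF bounded_bilinear_blinfun_apply])

section \<open>Derivatives along vector fields, in coordinates\<close>

lemma linear_euclidean_expansion:
  fixes L :: "'a::euclidean_space \<Rightarrow> 'b::real_vector"
  assumes "linear L"
  shows "L v = (\<Sum>b\<in>Basis. (v \<bullet> b) *\<^sub>R L b)"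
proof -
  have "L v = L (\<Sum>b\<in>Basis. (v \<bullet> b) *\<^sub>R b)" by (simp add: euclidean_representation)
  then show ?thesis by (simp add: linear_sum[OF assms] linear_cmul[OF assms])
qed

text \<open>Smoothness only controls derivatives in a fixed direction, whereas here the direction
  moves with the point. Expanding \<open>m x\<close> in the basis reduces to fixed directions with
  smooth coefficients.\<close>

lemma vf_apply_expansion:
  assumes "smooth f"
  shows "vf_apply m f = (\<lambda>x. \<Sum>b\<in>Basis. (m x \<bullet> b) *\<^sub>R frechet_derivative f (at x) b)"
  unfolding vf_apply_def
  by (rule ext, rule linear_euclidean_expansion,
      rule has_derivative_linear[OF smooth_has_derivative[OF assms]])

lemma smooth_inner: "smooth f \<Longrightarrow> smooth (\<lambda>x. f x \<bullet> b)"
  by (rule smooth_bilinear[OF bounded_bilinear_inner _ smooth_const])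

lemma smooth_vf_apply: "smooth m \<Longrightarrow> smooth f \<Longrightarrow> smooth (vf_apply m f)"
  by (simp add: vf_apply_expansion)
     (intro smooth_sum smooth_scaleR smooth_inner smooth_frechet_derivative)

lemma smooth_lie_bracket: "smooth m \<Longrightarrow> smooth m' \<Longrightarrow> smooth (lie_bracket m m')"
  unfolding lie_bracket_def by (intro smooth_diff smooth_vf_apply)

lemma vf_apply_diff:
  "smooth f \<Longrightarrow> smooth h \<Longrightarrow> vf_apply m (\<lambda>x. f x - h x) x = vf_apply m f x - vf_apply m h x"
  unfolding vf_apply_def
  by (simp add: frechet_derivative_eqI[OF has_derivative_diff[OF smooth_has_derivative smooth_has_derivative]])

subsection \<open>Symmetry of second derivatives\<close>

text \<open>The second difference of \<open>f\<close> over the parallelogram spanned by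
  \<open>h u\<close> and \<open>h v\<close> is \<open>h^2 L v\<close> up to \<open>o(h^2)\<close>,
  by the mean value inequality in the \<open>u\<close> direction.\<close>

lemma second_difference_bound:
  fixes f :: "'a::real_normed_vector \<Rightarrow> 'b::real_normed_vector"
  assumes f: "\<And>y. (f has_derivative f' y) (at y)"
    and L: "((\<lambda>y. f' y u) has_derivative L) (at x)"
    and "e > 0"
  obtains d where "d > 0" and
    "\<And>h. 0 < h \<Longrightarrow> h < d \<Longrightarrow>
       norm (f (x + h *\<^sub>R u + h *\<^sub>R v) - f (x + h *\<^sub>R u) - f (x + h *\<^sub>R v) + f x - (h * h) *\<^sub>R L v)
         \<le> e * (h * h)"
proof -
  \<comment> \<open>The two linearization errors below contribute \<open>norm u + norm v\<close> and
    \<open>norm u\<close>; the extra 1 keeps \<open>C\<close> positive when \<open>u\<close> and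
    \<open>v\<close> vanish.\<close>
  define C where "C = 2 * norm u + norm v + 1"
  have C: "C > 0" unfolding C_def by (smt (verit) norm_ge_zero)
  have lin: "linear L" using has_derivative_linear[OF L] .
  obtain d where d: "d > 0" and
    bd: "\<And>y. norm (y - x) < d \<Longrightarrow> norm (f' y u - f' x u - L (y - x)) \<le> e / C * norm (y - x)"
    using L[unfolded has_derivative_at_alt] \<open>e > 0\<close> C by (metis divide_pos_pos)
  show thesis
  proof (rule that)
    show "d / C > 0" using d C by simp
    fix h :: real
    assume h: "0 < h" "h < d / C"
    then have hd: "h * C < d" using C by (simp add: field_simps)
    \<comment> \<open>A first difference in direction \<open>v\<close>, moved along \<open>u\<close>
      and corrected linearly in \<open>s\<close>. Then \<open>\<psi> h - \<psi> 0\<close> is the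
      second difference minus \<open>h^2 L v\<close>, and \<open>D\<close> is the derivative of
      \<open>\<psi>\<close>.\<close>
    define \<psi> where "\<psi> = (\<lambda>s. f (x + s *\<^sub>R u + h *\<^sub>R v) - f (x + s *\<^sub>R u) - (s * h) *\<^sub>R L v)"
    define D where "D = (\<lambda>s. f' (x + s *\<^sub>R u + h *\<^sub>R v) u - f' (x + s *\<^sub>R u) u - h *\<^sub>R L v)"
    have D: "(\<psi> has_derivative (\<lambda>t. t *\<^sub>R D s)) (at s within {0..h})" for s
    proof -
      have 1: "((\<lambda>s. f (x + s *\<^sub>R u + c)) has_derivative (\<lambda>t. f' (x + s *\<^sub>R u + c) (t *\<^sub>R u)))
          (at s within {0..h})" for c
        by (rule has_derivative_compose[OF _ f]) (auto intro!: derivative_eq_intros)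
      have lf: "f' y (t *\<^sub>R u) = t *\<^sub>R f' y u" for y t
        using linear_cmul[OF has_derivative_linear[OF f]] .
      show ?thesis
        unfolding \<psi>_def D_def
        by (rule has_derivative_eq_rhs,
            rule has_derivative_diff[OF has_derivative_diff[OF 1[of "h *\<^sub>R v"] 1[of 0, simplified]]],
            (rule derivative_eq_intros refl)+)
           (simp add: lf algebra_simps)
    qed
    have B: "norm (D s) \<le> e * h" if s: "s \<in> {0..h}" for s
    proof -
      have n1: "norm (s *\<^sub>R u + h *\<^sub>R v) \<le> h * (norm u + norm v)"
        using s h norm_triangle_ineq[of "s *\<^sub>R u" "h *\<^sub>R v"] mult_right_mono[of s h "norm u"]
        by (simp add: algebra_simps)
      have n2: "norm (s *\<^sub>R u) \<le> h * norm u"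
        using s h by (simp add: mult_right_mono)
      have c1: "h * (norm u + norm v) < d" "h * norm u < d"
      proof -
        have "0 \<le> h * norm u" "0 \<le> h * norm v" using h by simp_all
        moreover have "h * C = 2 * (h * norm u) + h * norm v + h"
          by (simp add: C_def algebra_simps)
        ultimately show "h * (norm u + norm v) < d" "h * norm u < d"
          using hd h unfolding distrib_left by linarith+
      qed
      have b1: "norm (f' (x + s *\<^sub>R u + h *\<^sub>R v) u - f' x u - L (s *\<^sub>R u + h *\<^sub>R v))
          \<le> e / C * (h * (norm u + norm v))"
        using bd[of "x + s *\<^sub>R u + h *\<^sub>R v"] n1 c1 \<open>e > 0\<close> C
        by (smt (verit) add.assoc add_diff_cancel_left' divide_pos_pos mult_left_mono)
      have b2: "norm (f' (x + s *\<^sub>R u) u - f' x u - L (s *\<^sub>R u)) \<le> e / C * (h * norm u)"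
        using bd[of "x + s *\<^sub>R u"] n2 c1 \<open>e > 0\<close> C
        by (smt (verit) add_diff_cancel_left' divide_pos_pos mult_left_mono)
      \<comment> \<open>Linearizing both values of \<open>f'\<close> at \<open>x\<close>, the terms
        in \<open>L\<close> differ by exactly \<open>h L v\<close>, which the correction in
        \<open>D\<close> cancels; only the errors remain.\<close>
      have "D s = (f' (x + s *\<^sub>R u + h *\<^sub>R v) u - f' x u - L (s *\<^sub>R u + h *\<^sub>R v))
          - (f' (x + s *\<^sub>R u) u - f' x u - L (s *\<^sub>R u))"
        by (simp add: D_def linear_add[OF lin] linear_cmul[OF lin])
      also have "norm \<dots> \<le> e / C * (h * (norm u + norm v)) + e / C * (h * norm u)"
        using b1 b2 norm_triangle_ineq4 by (smt (verit))
      also have "\<dots> = e / C * (h * (norm u + norm v) + h * norm u)"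
        by (simp only: distrib_left)
      also have "h * (norm u + norm v) + h * norm u = h * (C - 1)"
        by (simp add: C_def algebra_simps)
      also have "e / C * (h * (C - 1)) \<le> e / C * (h * C)" using \<open>e > 0\<close> C h by (intro mult_left_mono) auto
      finally show ?thesis using C by simp
    qed
    have "norm (\<psi> h - \<psi> 0) \<le> e * h * norm (h - 0)"
      by (rule differentiable_bound[OF _ D])
         (use h B \<open>e > 0\<close> in \<open>auto intro!: onorm_le simp: mult.commute mult_left_mono\<close>)
    then show "norm (f (x + h *\<^sub>R u + h *\<^sub>R v) - f (x + h *\<^sub>R u) - f (x + h *\<^sub>R v) + f x - (h * h) *\<^sub>R L v)
         \<le> e * (h * h)"
      using h by (simp add: \<psi>_def algebra_simps)
  qed
qed

text \<open>The second difference is symmetric in \<open>u\<close> and \<open>v\<close>, yet is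
  approximated both by \<open>h^2 L v\<close> and by \<open>h^2 M u\<close>. Dividing by
  \<open>h^2\<close> makes their distance at most any \<open>e > 0\<close>.\<close>

lemma second_derivative_symmetric:
  fixes f :: "'a::real_normed_vector \<Rightarrow> 'b::real_normed_vector"
  assumes f: "\<And>y. (f has_derivative f' y) (at y)"
    and L: "((\<lambda>y. f' y u) has_derivative L) (at x)"
    and M: "((\<lambda>y. f' y v) has_derivative M) (at x)"
  shows "L v = M u"
proof -
  have "norm (L v - M u) \<le> 0 + e" if "e > 0" for e
  proof -
    from that have e: "e / 2 > 0" by simp
    let ?\<Delta> = "\<lambda>h. f (x + h *\<^sub>R u + h *\<^sub>R v) - f (x + h *\<^sub>R u) - f (x + h *\<^sub>R v) + f x"
    obtain d1 where d1: "d1 > 0"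
      "\<And>h. 0 < h \<Longrightarrow> h < d1 \<Longrightarrow> norm (?\<Delta> h - (h * h) *\<^sub>R L v) \<le> e / 2 * (h * h)"
      using second_difference_bound[OF f L e] by blast
    obtain d2 where d2: "d2 > 0"
      "\<And>h. 0 < h \<Longrightarrow> h < d2 \<Longrightarrow>
        norm (f (x + h *\<^sub>R v + h *\<^sub>R u) - f (x + h *\<^sub>R v) - f (x + h *\<^sub>R u) + f x - (h * h) *\<^sub>R M u)
          \<le> e / 2 * (h * h)"
      using second_difference_bound[OF f M e] by blast
    define h where "h = min d1 d2 / 2"
    have h: "0 < h" "h < d1" "h < d2" using d1 d2 by (auto simp: h_def)
    have eq: "f (x + h *\<^sub>R v + h *\<^sub>R u) - f (x + h *\<^sub>R v) - f (x + h *\<^sub>R u) + f x = ?\<Delta> h"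
      by (simp add: algebra_simps)
    have "(h * h) * norm (L v - M u) = norm ((?\<Delta> h - (h * h) *\<^sub>R M u) - (?\<Delta> h - (h * h) *\<^sub>R L v))"
      using h by (simp flip: scaleR_diff_right)
    also have "\<dots> \<le> e / 2 * (h * h) + e / 2 * (h * h)"
      using d1(2)[of h] d2(2)[of h, unfolded eq] h by (intro norm_triangle_le_diff) linarith
    finally have "(h * h) * norm (L v - M u) \<le> (h * h) * e" by (simp add: algebra_simps)
    then show ?thesis using h by simp
  qed
  then have "norm (L v - M u) \<le> 0" by (rule field_le_epsilon)
  then show ?thesis by simp
qed

section \<open>The Lie bracket as a commutator of derivations\<close>

lemma vf_apply_vf_apply:
  fixes f :: "'a::euclidean_space \<Rightarrow> 'b::real_normed_vector"
  assumes "smooth Y" "smooth f"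
  shows "vf_apply X (vf_apply Y f) x =
    (\<Sum>b\<in>Basis. (Y x \<bullet> b) *\<^sub>R frechet_derivative (\<lambda>y. frechet_derivative f (at y) b) (at x) (X x))
    + frechet_derivative f (at x) (frechet_derivative Y (at x) (X x))"
proof -
  note f = smooth_has_derivative[OF assms(2)] and Y = smooth_has_derivative[OF assms(1)]
  note f2 = smooth_has_derivative[OF smooth_frechet_derivative[OF assms(2)]]
  \<comment> \<open>Product rule on the basis expansion of \<open>Y f\<close>: one half is the
    second derivative of \<open>f\<close> in the directions \<open>X\<close> and \<open>Y\<close>,
    the other re-sums to \<open>f'\<close> applied to the derivative of \<open>Y\<close> along
    \<open>X\<close>.\<close>
  have "((\<lambda>x. \<Sum>b\<in>Basis. (Y x \<bullet> b) *\<^sub>R frechet_derivative f (at x) b) has_derivative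
      (\<lambda>h. \<Sum>b\<in>Basis. (Y x \<bullet> b) *\<^sub>R frechet_derivative (\<lambda>y. frechet_derivative f (at y) b) (at x) h
        + (frechet_derivative Y (at x) h \<bullet> b) *\<^sub>R frechet_derivative f (at x) b)) (at x)"
    by (intro has_derivative_sum has_derivative_scaleR has_derivative_inner_left f2 Y)
  then show ?thesis
    unfolding vf_apply_expansion[OF assms(2), of Y]
    by (simp add: vf_apply_def frechet_derivative_eqI sum.distrib
        linear_euclidean_expansion[OF has_derivative_linear[OF f], where v = "frechet_derivative Y (at x) (X x)"])
qed

text \<open>The second-order parts of \<open>X (Y f)\<close> and \<open>Y (X f)\<close> agree by
  symmetry, and the first-order parts differ by \<open>f'\<close> applied to the bracket. The
  general codomain allows \<open>f\<close> to be a function or a vector field.\<close>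

lemma vf_apply_lie_bracket:
  fixes f :: "'a::euclidean_space \<Rightarrow> 'b::real_normed_vector"
  assumes X: "smooth X" and Y: "smooth Y" and f: "smooth f"
  shows "vf_apply (lie_bracket X Y) f x = vf_apply X (vf_apply Y f) x - vf_apply Y (vf_apply X f) x"
proof -
  let ?H = "\<lambda>b. frechet_derivative (\<lambda>y. frechet_derivative f (at y) b) (at x)"
  note d = smooth_has_derivative[OF f]
  note d2 = smooth_has_derivative[OF smooth_frechet_derivative[OF f]]
  have e: "?H b v = (\<Sum>c\<in>Basis. (v \<bullet> c) *\<^sub>R ?H b c)" for b v
    by (rule linear_euclidean_expansion[OF has_derivative_linear[OF d2]])
  have sym: "?H b c = ?H c b" for b c
    by (rule second_derivative_symmetric[OF d d2 d2])
  \<comment> \<open>Expand \<open>X\<close> in the basis, exchange the two directions by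
    \<open>sym\<close>, swap the sums and collect \<open>Y\<close> again.\<close>
  have "(\<Sum>b\<in>Basis. (Y x \<bullet> b) *\<^sub>R ?H b (X x)) =
      (\<Sum>b\<in>Basis. \<Sum>c\<in>Basis. (X x \<bullet> c) *\<^sub>R (Y x \<bullet> b) *\<^sub>R ?H c b)"
    by (subst e, simp add: scaleR_sum_right sym mult.commute)
  also have "\<dots> = (\<Sum>c\<in>Basis. (X x \<bullet> c) *\<^sub>R ?H c (Y x))"
    by (subst sum.swap, subst (2) e, simp add: scaleR_sum_right)
  finally show ?thesis
    by (simp add: vf_apply_vf_apply[OF Y f] vf_apply_vf_apply[OF X f])
       (simp add: vf_apply_def lie_bracket_def linear_diff[OF has_derivative_linear[OF d]])
qed

text \<open>The bracket \<open>[Y, Z]\<close> acts on \<open>X\<close> as a commutator, which leaves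
  four iterated derivatives. Under cyclic permutation of \<open>X\<close>, \<open>Y\<close>,
  \<open>Z\<close> these cancel in pairs.\<close>

lemma lie_bracket_nested:
  assumes "smooth X" "smooth Y" "smooth Z"
  shows "lie_bracket X (lie_bracket Y Z) x =
    vf_apply X (vf_apply Y Z) x - vf_apply X (vf_apply Z Y) x
    - (vf_apply Y (vf_apply Z X) x - vf_apply Z (vf_apply Y X) x)"
proof -
  have "vf_apply X (lie_bracket Y Z) x = vf_apply X (vf_apply Y Z) x - vf_apply X (vf_apply Z Y) x"
    unfolding lie_bracket_def using assms by (simp add: vf_apply_diff smooth_vf_apply)
  then show ?thesis
    by (simp add: lie_bracket_def[of X] vf_apply_lie_bracket assms)
qed

subsection \<open>The modified bracket\<close>

text \<open>Expanding \<open>[X + a g, Y + b g]\<close> by the Leibniz rule gives, besides the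
  right-hand side, \<open>b [X, g] + a [g, Y] + (a g(b) - b g(a)) g\<close>. The two correction
  terms of the modified bracket remove exactly this.\<close>

lemma modified_bracket_decomposition:
  fixes g X Y :: "'a::euclidean_space \<Rightarrow> 'a"
  assumes "smooth g" "smooth X" "smooth Y" "smooth a" "smooth b"
    and nz: "\<And>x. pairing \<omega> g x \<noteq> 0"
    and ker: "\<And>x. pairing \<omega> X x = 0" "\<And>x. pairing \<omega> Y x = 0"
  shows "modified_bracket g \<omega> (\<lambda>x. X x + a x *\<^sub>R g x) (\<lambda>x. Y x + b x *\<^sub>R g x) =
    (\<lambda>x. lie_bracket X Y x + (vf_apply X b x - vf_apply Y a x) *\<^sub>R g x)"
proof
  fix x
  note d = assms(1-5)[THEN smooth_has_derivative]
  note l = d[THEN has_derivative_linear]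
  have p: "pairing \<omega> (\<lambda>x. X x + a x *\<^sub>R g x) x / pairing \<omega> g x = a x"
    "pairing \<omega> (\<lambda>x. Y x + b x *\<^sub>R g x) x / pairing \<omega> g x = b x"
    using nz[of x] ker[of x] by (simp_all add: pairing_def blinfun.add_right blinfun.scaleR_right)
  have D: "frechet_derivative (\<lambda>x. X x + a x *\<^sub>R g x) (at x) =
      (\<lambda>h. frechet_derivative X (at x) h + (a x *\<^sub>R frechet_derivative g (at x) h
        + frechet_derivative a (at x) h *\<^sub>R g x))"
    "frechet_derivative (\<lambda>x. Y x + b x *\<^sub>R g x) (at x) =
      (\<lambda>h. frechet_derivative Y (at x) h + (b x *\<^sub>R frechet_derivative g (at x) h
        + frechet_derivative b (at x) h *\<^sub>R g x))"
    by (intro frechet_derivative_eqI has_derivative_add has_derivative_scaleR d)+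
  show "modified_bracket g \<omega> (\<lambda>x. X x + a x *\<^sub>R g x) (\<lambda>x. Y x + b x *\<^sub>R g x) x =
      lie_bracket X Y x + (vf_apply X b x - vf_apply Y a x) *\<^sub>R g x"
    unfolding modified_bracket_def p lie_bracket_def vf_apply_def D
    by (simp add: l[THEN linear_add] l[THEN linear_cmul] algebra_simps)
qed

text \<open>On fields annihilated by \<omega>, differentiating \<open>\<omega>(X) = 0\<close> and
  \<open>\<omega>(Y) = 0\<close> gives \<open>d\<omega>(X, Y) = - \<omega>([X, Y])\<close>, so it
  suffices that \<open>d\<omega>(X, Y)\<close> vanishes.\<close>

lemma pairing_lie_bracket_eq_0:
  assumes \<omega>: "smooth \<omega>" and X: "smooth X" and Y: "smooth Y"
    and nz: "\<And>x. pairing \<omega> g x \<noteq> 0"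
    and frob: "wedge_2_1 (ext_deriv \<omega>) \<omega> = (\<lambda>x u v w. 0)"
    and ker: "\<And>x. pairing \<omega> X x = 0" "\<And>x. pairing \<omega> Y x = 0"
  shows "pairing \<omega> (lie_bracket X Y) x = 0"
proof -
  have leibniz: "blinfun_apply (frechet_derivative \<omega> (at x) h) (Z x)
      = - blinfun_apply (\<omega> x) (frechet_derivative Z (at x) h)"
    if Z: "smooth Z" and 0: "\<And>x. pairing \<omega> Z x = 0" for Z h
  proof -
    have "((\<lambda>x. blinfun_apply (\<omega> x) (Z x)) has_derivative
        (\<lambda>h. blinfun_apply (\<omega> x) (frechet_derivative Z (at x) h)
          + blinfun_apply (frechet_derivative \<omega> (at x) h) (Z x))) (at x)"
      by (rule bounded_bilinear.FDERIV[OF bounded_bilinear_blinfun_apply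
          smooth_has_derivative[OF \<omega>] smooth_has_derivative[OF Z]])
    from fun_cong[OF frechet_derivative_eqI[OF this], of h] show ?thesis
      using 0 by (simp add: pairing_def)
  qed
  \<comment> \<open>With \<open>g\<close> as third argument only
    \<open>d\<omega>(X, Y) \<omega>(g)\<close> survives, and \<open>\<omega>(g)\<close> is
    nonzero.\<close>
  have "wedge_2_1 (ext_deriv \<omega>) \<omega> x (X x) (Y x) (g x) = 0"
    by (simp add: frob)
  then have "ext_deriv \<omega> x (X x) (Y x) = 0"
    using nz[of x] ker[of x] by (simp add: wedge_2_1_def pairing_def)
  then show ?thesis
    by (simp add: ext_deriv_def leibniz[OF X ker(1)] leibniz[OF Y ker(2)] pairing_def
        lie_bracket_def vf_apply_def blinfun.diff_right)
qed

text \<open>The inner bracket again has the form \<open>W + e g\<close>, with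
  \<open>W = [Y, Z]\<close> in the kernel by integrability and \<open>e = Y(c) - Z(b)\<close>, so
  the decomposition applies twice. The coefficient of \<open>g\<close> is
  \<open>lie_bracket_nested\<close> with \<open>a\<close>, \<open>b\<close>, \<open>c\<close> as the
  innermost arguments.\<close>

lemma modified_bracket_nested:
  fixes g X Y Z :: "'a::euclidean_space \<Rightarrow> 'a"
  assumes \<omega>: "smooth \<omega>" and g: "smooth g"
    and X: "smooth X" "smooth a" and Y: "smooth Y" "smooth b" and Z: "smooth Z" "smooth c"
    and nz: "\<And>x. pairing \<omega> g x \<noteq> 0"
    and frob: "wedge_2_1 (ext_deriv \<omega>) \<omega> = (\<lambda>x u v w. 0)"
    and ker: "\<And>x. pairing \<omega> X x = 0" "\<And>x. pairing \<omega> Y x = 0" "\<And>x. pairing \<omega> Z x = 0"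
  shows "modified_bracket g \<omega> (\<lambda>x. X x + a x *\<^sub>R g x)
      (modified_bracket g \<omega> (\<lambda>x. Y x + b x *\<^sub>R g x) (\<lambda>x. Z x + c x *\<^sub>R g x)) x =
    lie_bracket X (lie_bracket Y Z) x +
    (vf_apply X (vf_apply Y c) x - vf_apply X (vf_apply Z b) x
      - (vf_apply Y (vf_apply Z a) x - vf_apply Z (vf_apply Y a) x)) *\<^sub>R g x"
proof -
  have s: "smooth (vf_apply Y c)" "smooth (vf_apply Z b)"
    using Y Z by (auto intro: smooth_vf_apply)
  show ?thesis
    unfolding modified_bracket_decomposition[OF g Y(1) Z(1) Y(2) Z(2) nz ker(2,3)]
      modified_bracket_decomposition[OF g X(1) smooth_lie_bracket[OF Y(1) Z(1)] X(2)
        smooth_diff[OF s] nz ker(1) pairing_lie_bracket_eq_0[OF \<omega> Y(1) Z(1) nz frob ker(2,3)]]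
    by (simp add: vf_apply_diff[OF s] vf_apply_lie_bracket[OF Y(1) Z(1) X(2)])
qed

section \<open>Splitting a field along the kernel and \<open>g\<close>, and the cyclic sum\<close>

lemma kernel_decomposition:
  fixes g m :: "'a::euclidean_space \<Rightarrow> 'a"
  assumes "smooth g" "smooth \<omega>" "smooth m" and nz: "\<And>x. pairing \<omega> g x \<noteq> 0"
  obtains X a where "smooth X" "smooth a" "\<And>x. pairing \<omega> X x = 0" "m = (\<lambda>x. X x + a x *\<^sub>R g x)"
proof -
  \<comment> \<open>Pairing \<open>m = X + a g\<close> with \<omega> forces this coefficient when
    \<open>X\<close> lies in the kernel.\<close>
  define a where "a = (\<lambda>x. pairing \<omega> m x / pairing \<omega> g x)"
  have a: "smooth a"
    unfolding a_def using assms by (intro smooth_divide smooth_pairing)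
  show thesis
  proof (rule that)
    show "smooth (\<lambda>x. m x - a x *\<^sub>R g x)" using assms a by (intro smooth_diff smooth_scaleR)
    show "pairing \<omega> (\<lambda>x. m x - a x *\<^sub>R g x) x = 0" for x
      using nz[of x] by (simp add: a_def pairing_def blinfun.diff_right blinfun.scaleR_right)
  qed (use a in auto)
qed

theorem lemma11:
  fixes g :: "real^'n \<Rightarrow> real^'n"
    and \<omega> :: "real^'n \<Rightarrow> ((real^'n) \<Rightarrow>\<^sub>L real)"
    and m\<^sub>1 m\<^sub>2 m\<^sub>3 :: "real^'n \<Rightarrow> real^'n"
  assumes "smooth g"
    and "smooth \<omega>"
    and "\<And>x. pairing \<omega> g x \<noteq> 0"
    and "wedge_2_1 (ext_deriv \<omega>) \<omega> = (\<lambda>x u v w. 0)"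
    and "smooth m\<^sub>1" and "smooth m\<^sub>2" and "smooth m\<^sub>3"
  shows "\<forall>x. modified_bracket g \<omega> m\<^sub>1 (modified_bracket g \<omega> m\<^sub>2 m\<^sub>3) x
           + modified_bracket g \<omega> m\<^sub>2 (modified_bracket g \<omega> m\<^sub>3 m\<^sub>1) x
           + modified_bracket g \<omega> m\<^sub>3 (modified_bracket g \<omega> m\<^sub>1 m\<^sub>2) x = 0"
proof -
  obtain X\<^sub>1 a\<^sub>1 where 1: "smooth X\<^sub>1" "smooth a\<^sub>1" "\<And>x. pairing \<omega> X\<^sub>1 x = 0"
    "m\<^sub>1 = (\<lambda>x. X\<^sub>1 x + a\<^sub>1 x *\<^sub>R g x)"
    using kernel_decomposition[OF assms(1,2,5,3)] by blast
  obtain X\<^sub>2 a\<^sub>2 where 2: "smooth X\<^sub>2" "smooth a\<^sub>2" "\<And>x. pairing \<omega> X\<^sub>2 x = 0"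
    "m\<^sub>2 = (\<lambda>x. X\<^sub>2 x + a\<^sub>2 x *\<^sub>R g x)"
    using kernel_decomposition[OF assms(1,2,6,3)] by blast
  obtain X\<^sub>3 a\<^sub>3 where 3: "smooth X\<^sub>3" "smooth a\<^sub>3" "\<And>x. pairing \<omega> X\<^sub>3 x = 0"
    "m\<^sub>3 = (\<lambda>x. X\<^sub>3 x + a\<^sub>3 x *\<^sub>R g x)"
    using kernel_decomposition[OF assms(1,2,7,3)] by blast
  note nested = modified_bracket_nested[OF assms(2,1) _ _ _ _ _ _ assms(3,4)]
  show ?thesis
    \<comment> \<open>Twelve iterated derivatives of the fields \<open>X\<^sub>i\<close> cancel in
      pairs, and so do the twelve of the functions \<open>a\<^sub>i\<close> in the coefficient of
      \<open>g\<close>.\<close>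
    by (simp add: 1 2 3 nested lie_bracket_nested algebra_simps)
qed

end
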